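(* Let $\{A,G,\sigma,\alpha\}$ be a crossed system in which $G$ is a groupoid with $ob(G)$ finite. Suppose that $A$ is maximal commutative in $A \rtimes_{\alpha}^{\sigma} G$ and that for every $s \in G$ the element $\alpha(s,s^{-1})$ is not a zero divisor in $A_{c(s)}$. Then for every nonzero twosided ideal $I$ of $A \rtimes_{\alpha}^{\sigma} G$, the intersection $I\cap A$ is nonzero (i.e. is not $\{0\}$).
   Context: Rings are associative and unital; ring homomorphisms preserve multiplicative identities. $G$ is a small category; an object is identified with its identity morphism; $s \in G$ means that $s$ is a morphism of $G$; $d(s)$ and $c(s)$ are the domain and codomain of $s$; $G^{(2)}$ is the set of pairs $(s,t)$ of morphisms with $d(s)=c(t)$ (so that $st$ is defined), and $G^{(3)}$ is the set of triples $(s,t,r)$ with $(s,t),(t,r)\in G^{(2)}$. A crossed system is a quadruple $\{A,G,\sigma,\alpha\}$ where $A$ is the direct sum of rings $A_e$, $e\in ob(G)$; $\sigma_s : A_{d(s)}\to A_{c(s)}$, $s\in G$, are ring homomorphisms; and $\alpha$ assigns to each $(s,t)\in G^{(2)}$ an element $\alpha(s,t)\in A_{c(s)}$, such that for all $e\in ob(G)$, all $(s,t,r)\in G^{(3)}$ and all $a\in A_{d(t)}$: $\sigma_e=\mathrm{id}_{A_e}$; $\alpha(s,d(s))=1_{A_{c(s)}}$; $\alpha(c(t),t)=1_{A_{c(t)}}$; $\alpha(s,t)\alpha(st,r)=\sigma_s(\alpha(t,r))\alpha(s,tr)$; $\sigma_s(\sigma_t(a))\alpha(s,t)=\alpha(s,t)\sigma_{st}(a)$.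 The category crossed product $A\rtimes_\alpha^\sigma G$ is the set of formal sums $\sum_{s\in G}a_su_s$ with $a_s\in A_{c(s)}$, all but finitely many zero, with componentwise addition and multiplication given by biadditive extension of $(a_su_s)(b_tu_t)=a_s\sigma_s(b_t)\alpha(s,t)u_{st}$ if $(s,t)\in G^{(2)}$ and $(a_su_s)(b_tu_t)=0$ otherwise; $u_s$ stands for $1_{A_{c(s)}}u_s$. When $ob(G)$ is finite its multiplicative identity is $\sum_{e\in ob(G)}u_e$. The ring $A$ is identified with the coefficient ring $\oplus_{e\in ob(G)}A_eu_e$. The commutant of a subset of a ring is the set of all elements of the ring commuting with every element of the subset. $A$ is maximal commutative in $A\rtimes_\alpha^\sigma G$ if $A$ is commutative and coincides with its commutant in $A\rtimes_\alpha^\sigma G$. An element $c$ of a commutative ring is a zero divisor if $cd=0$ for some nonzero $d$ in that ring (so $0$ is a zero divisor in a nonzero ring). *)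

theory Defs
  imports "HOL-Algebra.Ideal"
begin

section \<open>Small categories and groupoids\<close>

text \<open>
  Objects are identified with their identity morphisms, so a category is given by its set of
  morphisms together with domain, codomain and composition; the functions are only constrained
  on the morphisms, and composition only on the composable pairs.
\<close>

record 'g category_data =
  Mor :: "'g set"
  Dom :: "'g \<Rightarrow> 'g"
  Cod :: "'g \<Rightarrow> 'g"
  Comp :: "'g \<Rightarrow> 'g \<Rightarrow> 'g"  (infixl \<open>\<star>\<index>\<close> 70)

definition Ob :: "('g, 'n) category_data_scheme \<Rightarrow> 'g set" where
  "Ob G = {e \<in> Mor G. Dom G e = e}"

definition composable :: "('g, 'n) category_data_scheme \<Rightarrow> 'g \<Rightarrow> 'g \<Rightarrow> bool" where
  "composable G s t \<longleftrightarrow> s \<in> Mor G \<and> t \<in> Mor G \<and> Dom G s = Cod G t"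

locale small_category =
  fixes G :: "('g, 'n) category_data_scheme" (structure)
  assumes Dom_Ob: "s \<in> Mor G \<Longrightarrow> Dom G s \<in> Ob G"
    and Cod_Ob: "s \<in> Mor G \<Longrightarrow> Cod G s \<in> Ob G"
    and Cod_id: "e \<in> Ob G \<Longrightarrow> Cod G e = e"
    and Comp_Mor: "composable G s t \<Longrightarrow> s \<star> t \<in> Mor G"
    and Dom_Comp: "composable G s t \<Longrightarrow> Dom G (s \<star> t) = Dom G t"
    and Cod_Comp: "composable G s t \<Longrightarrow> Cod G (s \<star> t) = Cod G s"
    and Comp_assoc:
      "composable G s t \<Longrightarrow> composable G t r \<Longrightarrow> (s \<star> t) \<star> r = s \<star> (t \<star> r)"
    and Comp_Dom: "s \<in> Mor G \<Longrightarrow> s \<star> Dom G s = s"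
    and Cod_Comp_id: "s \<in> Mor G \<Longrightarrow> Cod G s \<star> s = s"

definition is_inverse :: "('g, 'n) category_data_scheme \<Rightarrow> 'g \<Rightarrow> 'g \<Rightarrow> bool" where
  "is_inverse G s t \<longleftrightarrow> composable G s t \<and> composable G t s \<and>
     s \<star>\<^bsub>G\<^esub> t = Cod G s \<and> t \<star>\<^bsub>G\<^esub> s = Dom G s"

definition mor_inv :: "('g, 'n) category_data_scheme \<Rightarrow> 'g \<Rightarrow> 'g" where
  "mor_inv G s = (THE t. is_inverse G s t)"

locale groupoid = small_category +
  assumes ex_inverse: "s \<in> Mor G \<Longrightarrow> \<exists>t. is_inverse G s t"

lemma (in small_category) is_inverse_unique:
  assumes "is_inverse G s t" "is_inverse G s t'"
  shows "t = t'"
proof -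
  have "t = t \<star> (s \<star> t')"
    using assms Comp_Dom[of t] by (auto simp: is_inverse_def composable_def)
  also have "\<dots> = (t \<star> s) \<star> t'"
    using assms Comp_assoc[of t s t'] by (simp add: is_inverse_def)
  also have "\<dots> = t'"
    using assms Cod_Comp_id[of t'] by (auto simp: is_inverse_def composable_def)
  finally show ?thesis .
qed

lemma (in groupoid) mor_inv_is_inverse: "s \<in> Mor G \<Longrightarrow> is_inverse G s (mor_inv G s)"
  unfolding mor_inv_def using ex_inverse is_inverse_unique by (metis theI)

section \<open>Crossed systems\<close>

text \<open>
  The family \<open>A\<close> matters only at the objects of \<open>G\<close>, \<open>\<sigma>\<close> only at the morphisms, and \<open>\<alpha>\<close> only at
  the composable pairs.  The rings of the family share one element type, but carry their own
  carriers and operations.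
\<close>

locale crossed_system = small_category G
  for A :: "'g \<Rightarrow> ('a, 'm) ring_scheme"
    and G :: "('g, 'n) category_data_scheme"
    and \<sigma> :: "'g \<Rightarrow> 'a \<Rightarrow> 'a"
    and \<alpha> :: "'g \<Rightarrow> 'g \<Rightarrow> 'a" +
  assumes A_ring: "e \<in> Ob G \<Longrightarrow> ring (A e)"
    and \<sigma>_hom: "s \<in> Mor G \<Longrightarrow> \<sigma> s \<in> ring_hom (A (Dom G s)) (A (Cod G s))"
    and \<alpha>_closed: "composable G s t \<Longrightarrow> \<alpha> s t \<in> carrier (A (Cod G s))"
    and \<sigma>_id: "e \<in> Ob G \<Longrightarrow> a \<in> carrier (A e) \<Longrightarrow> \<sigma> e a = a"
    and \<alpha>_Dom: "s \<in> Mor G \<Longrightarrow> \<alpha> s (Dom G s) = \<one>\<^bsub>A (Cod G s)\<^esub>"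
    and \<alpha>_Cod: "t \<in> Mor G \<Longrightarrow> \<alpha> (Cod G t) t = \<one>\<^bsub>A (Cod G t)\<^esub>"
    and \<alpha>_cocycle: "composable G s t \<Longrightarrow> composable G t r \<Longrightarrow>
      \<alpha> s t \<otimes>\<^bsub>A (Cod G s)\<^esub> \<alpha> (s \<star>\<^bsub>G\<^esub> t) r = \<sigma> s (\<alpha> t r) \<otimes>\<^bsub>A (Cod G s)\<^esub> \<alpha> s (t \<star>\<^bsub>G\<^esub> r)"
    and \<sigma>_twist: "composable G s t \<Longrightarrow> a \<in> carrier (A (Dom G t)) \<Longrightarrow>
      \<sigma> s (\<sigma> t a) \<otimes>\<^bsub>A (Cod G s)\<^esub> \<alpha> s t = \<alpha> s t \<otimes>\<^bsub>A (Cod G s)\<^esub> \<sigma> (s \<star>\<^bsub>G\<^esub> t) a"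

section \<open>The category crossed product\<close>

text \<open>
  The formal sum \<open>\<Sum> a\<^sub>s u\<^sub>s\<close> is represented by its coefficient function \<open>s \<mapsto> a\<^sub>s\<close>.  In the product,
  the coefficient at \<open>r\<close> collects the contributions of all factorisations \<open>r = s \<star> t\<close> with \<open>s\<close> and
  \<open>t\<close> in the supports of the factors.  The field \<^const>\<open>one\<close> holds \<open>\<Sum> u\<^sub>e\<close>, which lies in
  the carrier if there are only finitely many objects.
\<close>

definition supp ::
  "('g \<Rightarrow> ('a, 'm) ring_scheme) \<Rightarrow> ('g, 'n) category_data_scheme \<Rightarrow> ('g \<Rightarrow> 'a) \<Rightarrow> 'g set" where
  "supp A G f = {s \<in> Mor G. f s \<noteq> \<zero>\<^bsub>A (Cod G s)\<^esub>}"

definition crossed_product ::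
  "('g \<Rightarrow> ('a, 'm) ring_scheme) \<Rightarrow> ('g, 'n) category_data_scheme \<Rightarrow>
    ('g \<Rightarrow> 'a \<Rightarrow> 'a) \<Rightarrow> ('g \<Rightarrow> 'g \<Rightarrow> 'a) \<Rightarrow> ('g \<Rightarrow> 'a) ring" where
  "crossed_product A G \<sigma> \<alpha> = \<lparr>
     carrier = {f \<in> (\<Pi>\<^sub>E s\<in>Mor G. carrier (A (Cod G s))). finite (supp A G f)},
     mult = (\<lambda>f g. \<lambda>r\<in>Mor G. finsum (A (Cod G r))
        (\<lambda>(s, t). f s \<otimes>\<^bsub>A (Cod G r)\<^esub> \<sigma> s (g t) \<otimes>\<^bsub>A (Cod G r)\<^esub> \<alpha> s t)
        {(s, t). s \<in> supp A G f \<and> t \<in> supp A G g \<and> composable G s t \<and> s \<star>\<^bsub>G\<^esub> t = r}),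
     one = (\<lambda>s\<in>Mor G. if s \<in> Ob G then \<one>\<^bsub>A s\<^esub> else \<zero>\<^bsub>A (Cod G s)\<^esub>),
     zero = (\<lambda>s\<in>Mor G. \<zero>\<^bsub>A (Cod G s)\<^esub>),
     add = (\<lambda>f g. \<lambda>s\<in>Mor G. f s \<oplus>\<^bsub>A (Cod G s)\<^esub> g s) \<rparr>"

text \<open>The copy \<open>\<Oplus> A\<^sub>e u\<^sub>e\<close> of the direct sum of the rings \<open>A\<^sub>e\<close> in the crossed product:\<close>

definition coeff_ring ::
  "('g \<Rightarrow> ('a, 'm) ring_scheme) \<Rightarrow> ('g, 'n) category_data_scheme \<Rightarrow>
    ('g \<Rightarrow> 'a \<Rightarrow> 'a) \<Rightarrow> ('g \<Rightarrow> 'g \<Rightarrow> 'a) \<Rightarrow> ('g \<Rightarrow> 'a) set" where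
  "coeff_ring A G \<sigma> \<alpha> = {f \<in> carrier (crossed_product A G \<sigma> \<alpha>). supp A G f \<subseteq> Ob G}"

section \<open>Commutants and zero divisors\<close>

definition commutant :: "('b, 'k) ring_scheme \<Rightarrow> 'b set \<Rightarrow> 'b set" where
  "commutant R S = {x \<in> carrier R. \<forall>y\<in>S. x \<otimes>\<^bsub>R\<^esub> y = y \<otimes>\<^bsub>R\<^esub> x}"

definition maximal_commutative :: "('b, 'k) ring_scheme \<Rightarrow> 'b set \<Rightarrow> bool" where
  "maximal_commutative R S \<longleftrightarrow>
     (\<forall>x\<in>S. \<forall>y\<in>S. x \<otimes>\<^bsub>R\<^esub> y = y \<otimes>\<^bsub>R\<^esub> x) \<and> commutant R S = S"

definition zero_divisor :: "('b, 'k) ring_scheme \<Rightarrow> 'b \<Rightarrow> bool" where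
  "zero_divisor R c \<longleftrightarrow> (\<exists>d\<in>carrier R. d \<noteq> \<zero>\<^bsub>R\<^esub> \<and> c \<otimes>\<^bsub>R\<^esub> d = \<zero>\<^bsub>R\<^esub>)"

section \<open>The crossed product is a ring\<close>

definition monomial ::
  "('g \<Rightarrow> ('a, 'm) ring_scheme) \<Rightarrow> ('g, 'n) category_data_scheme \<Rightarrow> 'g \<Rightarrow> 'a \<Rightarrow> 'g \<Rightarrow> 'a" where
  "monomial A G s a = (\<lambda>r\<in>Mor G. if r = s then a else \<zero>\<^bsub>A (Cod G r)\<^esub>)"

context crossed_system
begin

abbreviation P :: "('g \<Rightarrow> 'a) ring" where "P \<equiv> crossed_product A G \<sigma> \<alpha>"

abbreviation R :: "'g \<Rightarrow> ('a, 'm) ring_scheme" where "R s \<equiv> A (Cod G s)"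

abbreviation term_at :: "('g \<Rightarrow> 'a) \<Rightarrow> ('g \<Rightarrow> 'a) \<Rightarrow> 'g \<Rightarrow> 'g \<times> 'g \<Rightarrow> 'a" where
  "term_at f g r \<equiv> \<lambda>(s, t). f s \<otimes>\<^bsub>R r\<^esub> \<sigma> s (g t) \<otimes>\<^bsub>R r\<^esub> \<alpha> s t"

abbreviation pairs :: "'g set \<Rightarrow> 'g set \<Rightarrow> 'g \<Rightarrow> ('g \<times> 'g) set" where
  "pairs S T r \<equiv> {(s, t). s \<in> S \<and> t \<in> T \<and> composable G s t \<and> s \<star>\<^bsub>G\<^esub> t = r}"

lemma ring_R: "s \<in> Mor G \<Longrightarrow> ring (R s)"
  using A_ring Cod_Ob by blast

lemma composableD:
  assumes "composable G s t"
  shows "s \<in> Mor G" "t \<in> Mor G" "Dom G s = Cod G t" "s \<star>\<^bsub>G\<^esub> t \<in> Mor G"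
    "Cod G (s \<star>\<^bsub>G\<^esub> t) = Cod G s" "Dom G (s \<star>\<^bsub>G\<^esub> t) = Dom G t"
  using assms Comp_Mor Cod_Comp Dom_Comp by (auto simp: composable_def)

lemma \<sigma>_closed: "composable G s t \<Longrightarrow> a \<in> carrier (R t) \<Longrightarrow> \<sigma> s a \<in> carrier (R s)"
  using ring_hom_closed[OF \<sigma>_hom[of s]] composableD[of s t] by simp

lemma carrier_memD: "f \<in> carrier P \<Longrightarrow> s \<in> Mor G \<Longrightarrow> f s \<in> carrier (R s)"
  by (auto simp: crossed_product_def)

lemma carrier_finite: "f \<in> carrier P \<Longrightarrow> finite (supp A G f)"
  by (auto simp: crossed_product_def)

lemma carrier_ext: "f \<in> carrier P \<Longrightarrow> f \<in> extensional (Mor G)"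
  by (auto simp: crossed_product_def PiE_def)

lemma carrierI:
  assumes "\<And>s. s \<in> Mor G \<Longrightarrow> f s \<in> carrier (R s)" "f \<in> extensional (Mor G)"
    "S \<supseteq> supp A G f" "finite S"
  shows "f \<in> carrier P"
  using assms by (auto simp: crossed_product_def PiE_def intro: finite_subset)

lemma ext_eqI:
  "f \<in> extensional (Mor G) \<Longrightarrow> g \<in> extensional (Mor G) \<Longrightarrow> (\<And>s. s \<in> Mor G \<Longrightarrow> f s = g s) \<Longrightarrow> f = g"
  by (rule extensionalityI)

lemma add_apply: "s \<in> Mor G \<Longrightarrow> (f \<oplus>\<^bsub>P\<^esub> g) s = f s \<oplus>\<^bsub>R s\<^esub> g s"
  by (simp add: crossed_product_def)

lemma zero_apply: "s \<in> Mor G \<Longrightarrow> \<zero>\<^bsub>P\<^esub> s = \<zero>\<^bsub>R s\<^esub>"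
  by (simp add: crossed_product_def)

lemma op_ext:
  "f \<oplus>\<^bsub>P\<^esub> g \<in> extensional (Mor G)" "f \<otimes>\<^bsub>P\<^esub> g \<in> extensional (Mor G)"
  "\<zero>\<^bsub>P\<^esub> \<in> extensional (Mor G)" "\<one>\<^bsub>P\<^esub> \<in> extensional (Mor G)"
  by (auto simp: crossed_product_def)

lemma add_closed_P:
  assumes "f \<in> carrier P" "g \<in> carrier P"
  shows "f \<oplus>\<^bsub>P\<^esub> g \<in> carrier P"
proof (rule carrierI)
  fix s assume s: "s \<in> Mor G"
  interpret ring "R s" using s by (rule ring_R)
  show "(f \<oplus>\<^bsub>P\<^esub> g) s \<in> carrier (R s)"
    using s assms by (simp add: add_apply carrier_memD)
next
  show "supp A G (f \<oplus>\<^bsub>P\<^esub> g) \<subseteq> supp A G f \<union> supp A G g"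
  proof
    fix s assume a: "s \<in> supp A G (f \<oplus>\<^bsub>P\<^esub> g)"
    then have s: "s \<in> Mor G" by (simp add: supp_def)
    interpret ring "R s" using s by (rule ring_R)
    show "s \<in> supp A G f \<union> supp A G g"
      using a s by (auto simp: supp_def add_apply)
  qed
qed (use assms carrier_finite op_ext in auto)

lemma zero_closed_P: "\<zero>\<^bsub>P\<^esub> \<in> carrier P"
proof (rule carrierI)
  fix s assume s: "s \<in> Mor G"
  interpret ring "R s" using s by (rule ring_R)
  show "\<zero>\<^bsub>P\<^esub> s \<in> carrier (R s)" using s by (simp add: zero_apply)
next
  show "supp A G \<zero>\<^bsub>P\<^esub> \<subseteq> {}" by (auto simp: supp_def zero_apply)
qed (auto simp: op_ext)

lemma abelian_group_P: "abelian_group P"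
proof (rule abelian_groupI)
  fix f g h assume fgh: "f \<in> carrier P" "g \<in> carrier P" "h \<in> carrier P"
  show "f \<oplus>\<^bsub>P\<^esub> g \<oplus>\<^bsub>P\<^esub> h = f \<oplus>\<^bsub>P\<^esub> (g \<oplus>\<^bsub>P\<^esub> h)"
  proof (rule ext_eqI)
    fix s assume s: "s \<in> Mor G"
    interpret ring "R s" using s by (rule ring_R)
    show "(f \<oplus>\<^bsub>P\<^esub> g \<oplus>\<^bsub>P\<^esub> h) s = (f \<oplus>\<^bsub>P\<^esub> (g \<oplus>\<^bsub>P\<^esub> h)) s"
      using s fgh by (simp add: add_apply a_assoc carrier_memD)
  qed (auto simp: op_ext)
next
  fix f g assume fg: "f \<in> carrier P" "g \<in> carrier P"
  show "f \<oplus>\<^bsub>P\<^esub> g = g \<oplus>\<^bsub>P\<^esub> f"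
  proof (rule ext_eqI)
    fix s assume s: "s \<in> Mor G"
    interpret ring "R s" using s by (rule ring_R)
    show "(f \<oplus>\<^bsub>P\<^esub> g) s = (g \<oplus>\<^bsub>P\<^esub> f) s"
      using s fg by (simp add: add_apply a_comm carrier_memD)
  qed (auto simp: op_ext)
next
  fix f assume f: "f \<in> carrier P"
  show "\<zero>\<^bsub>P\<^esub> \<oplus>\<^bsub>P\<^esub> f = f"
  proof (rule ext_eqI)
    fix s assume s: "s \<in> Mor G"
    interpret ring "R s" using s by (rule ring_R)
    show "(\<zero>\<^bsub>P\<^esub> \<oplus>\<^bsub>P\<^esub> f) s = f s"
      using s f by (simp add: add_apply zero_apply carrier_memD)
  qed (auto simp: op_ext carrier_ext f)
  define g where "g = (\<lambda>s\<in>Mor G. \<ominus>\<^bsub>R s\<^esub> f s)"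
  have "g \<in> carrier P"
  proof (rule carrierI)
    fix s assume s: "s \<in> Mor G"
    interpret ring "R s" using s by (rule ring_R)
    show "g s \<in> carrier (R s)" using s f by (simp add: g_def carrier_memD)
  next
    show "supp A G g \<subseteq> supp A G f"
    proof
      fix s assume a: "s \<in> supp A G g"
      then have s: "s \<in> Mor G" by (simp add: supp_def)
      interpret ring "R s" using s by (rule ring_R)
      show "s \<in> supp A G f" using a s by (auto simp: supp_def g_def)
    qed
  qed (auto simp: g_def carrier_finite f)
  moreover have "g \<oplus>\<^bsub>P\<^esub> f = \<zero>\<^bsub>P\<^esub>"
  proof (rule ext_eqI)
    fix s assume s: "s \<in> Mor G"
    interpret ring "R s" using s by (rule ring_R)
    show "(g \<oplus>\<^bsub>P\<^esub> f) s = \<zero>\<^bsub>P\<^esub> s"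
      using s f by (simp add: add_apply zero_apply carrier_memD g_def l_neg)
  qed (auto simp: op_ext)
  ultimately show "\<exists>g\<in>carrier P. g \<oplus>\<^bsub>P\<^esub> f = \<zero>\<^bsub>P\<^esub>" by blast
qed (auto intro: add_closed_P zero_closed_P)

lemma \<sigma>_zero: "composable G s t \<Longrightarrow> \<sigma> s \<zero>\<^bsub>R t\<^esub> = \<zero>\<^bsub>R s\<^esub>"
  using ring_hom_zero[OF \<sigma>_hom[of s]] ring_R[of s] ring_R[of t] composableD[of s t] by simp

lemma term_closed:
  assumes "f \<in> carrier P" "g \<in> carrier P" "composable G s t" "s \<star>\<^bsub>G\<^esub> t = r"
  shows "f s \<otimes>\<^bsub>R r\<^esub> \<sigma> s (g t) \<otimes>\<^bsub>R r\<^esub> \<alpha> s t \<in> carrier (R r)"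
proof -
  note st = composableD[OF assms(3)]
  interpret ring "R s" using st(1) by (rule ring_R)
  show ?thesis
    using st assms \<alpha>_closed[OF assms(3)] \<sigma>_closed[OF assms(3) carrier_memD]
    by (auto simp: carrier_memD)
qed

lemma term_zero:
  assumes "f \<in> carrier P" "g \<in> carrier P" "composable G s t" "s \<star>\<^bsub>G\<^esub> t = r"
    "s \<notin> supp A G f \<or> t \<notin> supp A G g"
  shows "f s \<otimes>\<^bsub>R r\<^esub> \<sigma> s (g t) \<otimes>\<^bsub>R r\<^esub> \<alpha> s t = \<zero>\<^bsub>R r\<^esub>"
proof -
  note st = composableD[OF assms(3)]
  interpret ring "R s" using st(1) by (rule ring_R)
  have "f s = \<zero>\<^bsub>R s\<^esub> \<or> g t = \<zero>\<^bsub>R t\<^esub>" using assms(5) st by (auto simp: supp_def)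
  then show ?thesis
    using st assms \<alpha>_closed[OF assms(3)] \<sigma>_closed[OF assms(3) carrier_memD] \<sigma>_zero[OF assms(3)]
    by (auto simp: carrier_memD)
qed

lemma finite_pairs: "finite S \<Longrightarrow> finite T \<Longrightarrow> finite (pairs S T r)"
  by (rule finite_subset[of _ "S \<times> T"]) auto

lemma mult_apply:
  assumes "f \<in> carrier P" "g \<in> carrier P" "r \<in> Mor G"
    "finite S" "finite T" "supp A G f \<subseteq> S" "supp A G g \<subseteq> T"
  shows "(f \<otimes>\<^bsub>P\<^esub> g) r = finsum (R r) (term_at f g r) (pairs S T r)"
proof -
  interpret ring "R r" using assms(3) by (rule ring_R)
  have "(f \<otimes>\<^bsub>P\<^esub> g) r = finsum (R r) (term_at f g r) (pairs (supp A G f) (supp A G g) r)"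
    using assms(3) by (simp add: crossed_product_def)
  also have "\<dots> = finsum (R r) (term_at f g r) (pairs S T r)"
  proof (rule add.finprod_mono_neutral_cong_left)
    fix p assume "p \<in> pairs S T r - pairs (supp A G f) (supp A G g) r"
    then obtain s t where "p = (s, t)" "composable G s t" "s \<star>\<^bsub>G\<^esub> t = r"
      "s \<notin> supp A G f \<or> t \<notin> supp A G g" by auto
    then show "term_at f g r p = \<zero>\<^bsub>R r\<^esub>"
      using term_zero assms(1,2) by simp
  qed (use assms in \<open>auto simp: term_closed intro!: finite_pairs\<close>)
  finally show ?thesis .
qed

lemma mult_closed_P:
  assumes "f \<in> carrier P" "g \<in> carrier P"
  shows "f \<otimes>\<^bsub>P\<^esub> g \<in> carrier P"
proof (rule carrierI)
  note * = mult_apply[OF assms _ carrier_finite[OF assms(1)] carrier_finite[OF assms(2)] order.refl order.refl]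
  fix r assume r: "r \<in> Mor G"
  interpret ring "R r" using r by (rule ring_R)
  show "(f \<otimes>\<^bsub>P\<^esub> g) r \<in> carrier (R r)"
    unfolding *[OF r] by (rule finsum_closed) (use assms in \<open>auto simp: term_closed\<close>)
next
  note * = mult_apply[OF assms _ carrier_finite[OF assms(1)] carrier_finite[OF assms(2)] order.refl order.refl]
  show "supp A G (f \<otimes>\<^bsub>P\<^esub> g) \<subseteq> (\<lambda>(s, t). s \<star>\<^bsub>G\<^esub> t) ` (supp A G f \<times> supp A G g)"
  proof (rule subsetI, rule ccontr)
    fix r assume r: "r \<in> supp A G (f \<otimes>\<^bsub>P\<^esub> g)"
      and n: "r \<notin> (\<lambda>(s, t). s \<star>\<^bsub>G\<^esub> t) ` (supp A G f \<times> supp A G g)"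
    have rM: "r \<in> Mor G" using r by (simp add: supp_def)
    interpret ring "R r" using rM by (rule ring_R)
    have "pairs (supp A G f) (supp A G g) r = {}" using n by auto
    then have "(f \<otimes>\<^bsub>P\<^esub> g) r = \<zero>\<^bsub>R r\<^esub>" using *[OF rM] by (simp only: finsum_empty)
    then show False using r by (simp add: supp_def)
  qed
qed (use assms carrier_finite op_ext in auto)

lemma l_distr_P:
  assumes "f \<in> carrier P" "g \<in> carrier P" "h \<in> carrier P"
  shows "(f \<oplus>\<^bsub>P\<^esub> g) \<otimes>\<^bsub>P\<^esub> h = f \<otimes>\<^bsub>P\<^esub> h \<oplus>\<^bsub>P\<^esub> g \<otimes>\<^bsub>P\<^esub> h"
proof (rule ext_eqI)
  fix r assume r: "r \<in> Mor G"
  interpret ring "R r" using r by (rule ring_R)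
  define S where "S = supp A G f \<union> supp A G g \<union> supp A G (f \<oplus>\<^bsub>P\<^esub> g)"
  define T where "T = supp A G h"
  have fin: "finite S" "finite T"
    using assms carrier_finite add_closed_P by (auto simp: S_def T_def)
  have sub: "supp A G f \<subseteq> S" "supp A G g \<subseteq> S" "supp A G (f \<oplus>\<^bsub>P\<^esub> g) \<subseteq> S" "supp A G h \<subseteq> T"
    by (auto simp: S_def T_def)
  have "((f \<oplus>\<^bsub>P\<^esub> g) \<otimes>\<^bsub>P\<^esub> h) r = finsum (R r) (term_at (f \<oplus>\<^bsub>P\<^esub> g) h r) (pairs S T r)"
    by (rule mult_apply) (use assms r fin sub add_closed_P in auto)
  also have "\<dots> = finsum (R r) (\<lambda>p. term_at f h r p \<oplus>\<^bsub>R r\<^esub> term_at g h r p) (pairs S T r)"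
    (is "_ = finsum _ ?sum ?pairs")
  proof (rule finsum_cong')
    fix p assume "p \<in> pairs S T r"
    then obtain s t where p: "p = (s, t)" "composable G s t" "s \<star>\<^bsub>G\<^esub> t = r" by auto
    note st = composableD[OF p(2)]
    interpret Rs: ring "R s" using st(1) by (rule ring_R)
    show "term_at (f \<oplus>\<^bsub>P\<^esub> g) h r p = term_at f h r p \<oplus>\<^bsub>R r\<^esub> term_at g h r p"
      using p st assms carrier_memD[of f s] carrier_memD[of g s] \<alpha>_closed[OF p(2)]
        \<sigma>_closed[OF p(2) carrier_memD[of h t]]
      by (auto simp: add_apply Rs.l_distr)
  next
    show "?sum \<in> ?pairs \<rightarrow> carrier (R r)"
    proof (rule Pi_I)
      fix p assume "p \<in> ?pairs"
      then obtain s t where p: "p = (s, t)" "composable G s t" "s \<star>\<^bsub>G\<^esub> t = r" by auto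
      show "?sum p \<in> carrier (R r)"
        unfolding p(1) prod.case by (intro a_closed term_closed assms p)
    qed
  qed auto
  also have "\<dots> = finsum (R r) (term_at f h r) (pairs S T r)
      \<oplus>\<^bsub>R r\<^esub> finsum (R r) (term_at g h r) (pairs S T r)"
    by (rule finsum_addf) (use assms in \<open>auto simp: term_closed\<close>)
  also have "\<dots> = (f \<otimes>\<^bsub>P\<^esub> h \<oplus>\<^bsub>P\<^esub> g \<otimes>\<^bsub>P\<^esub> h) r"
    using r assms fin sub by (simp add: add_apply mult_apply[of _ _ _ S T])
  finally show "((f \<oplus>\<^bsub>P\<^esub> g) \<otimes>\<^bsub>P\<^esub> h) r = (f \<otimes>\<^bsub>P\<^esub> h \<oplus>\<^bsub>P\<^esub> g \<otimes>\<^bsub>P\<^esub> h) r" .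
qed (auto simp: op_ext)

lemma r_distr_P:
  assumes "f \<in> carrier P" "g \<in> carrier P" "h \<in> carrier P"
  shows "h \<otimes>\<^bsub>P\<^esub> (f \<oplus>\<^bsub>P\<^esub> g) = h \<otimes>\<^bsub>P\<^esub> f \<oplus>\<^bsub>P\<^esub> h \<otimes>\<^bsub>P\<^esub> g"
proof (rule ext_eqI)
  fix r assume r: "r \<in> Mor G"
  interpret ring "R r" using r by (rule ring_R)
  define S where "S = supp A G f \<union> supp A G g \<union> supp A G (f \<oplus>\<^bsub>P\<^esub> g)"
  define T where "T = supp A G h"
  have fin: "finite S" "finite T"
    using assms carrier_finite add_closed_P by (auto simp: S_def T_def)
  have sub: "supp A G f \<subseteq> S" "supp A G g \<subseteq> S" "supp A G (f \<oplus>\<^bsub>P\<^esub> g) \<subseteq> S" "supp A G h \<subseteq> T"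
    by (auto simp: S_def T_def)
  have "(h \<otimes>\<^bsub>P\<^esub> (f \<oplus>\<^bsub>P\<^esub> g)) r = finsum (R r) (term_at h (f \<oplus>\<^bsub>P\<^esub> g) r) (pairs T S r)"
    by (rule mult_apply) (use assms r fin sub add_closed_P in auto)
  also have "\<dots> = finsum (R r) (\<lambda>p. term_at h f r p \<oplus>\<^bsub>R r\<^esub> term_at h g r p) (pairs T S r)"
    (is "_ = finsum _ ?sum ?pairs")
  proof (rule finsum_cong')
    fix p assume "p \<in> pairs T S r"
    then obtain s t where p: "p = (s, t)" "composable G s t" "s \<star>\<^bsub>G\<^esub> t = r" by auto
    note st = composableD[OF p(2)]
    interpret Rs: ring "R s" using st(1) by (rule ring_R)
    have ft: "f t \<in> carrier (R t)" "g t \<in> carrier (R t)"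
      using assms st by (auto simp: carrier_memD)
    then have "\<sigma> s (f t \<oplus>\<^bsub>R t\<^esub> g t) = \<sigma> s (f t) \<oplus>\<^bsub>R s\<^esub> \<sigma> s (g t)"
      using ring_hom_add[OF \<sigma>_hom[OF st(1)]] st by simp
    then show "term_at h (f \<oplus>\<^bsub>P\<^esub> g) r p = term_at h f r p \<oplus>\<^bsub>R r\<^esub> term_at h g r p"
      using p st assms carrier_memD[of h s] \<alpha>_closed[OF p(2)]
        \<sigma>_closed[OF p(2) ft(1)] \<sigma>_closed[OF p(2) ft(2)]
      by (auto simp: add_apply Rs.l_distr Rs.r_distr)
  next
    show "?sum \<in> ?pairs \<rightarrow> carrier (R r)"
    proof (rule Pi_I)
      fix p assume "p \<in> ?pairs"
      then obtain s t where p: "p = (s, t)" "composable G s t" "s \<star>\<^bsub>G\<^esub> t = r" by auto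
      show "?sum p \<in> carrier (R r)"
        unfolding p(1) prod.case by (intro a_closed term_closed assms p)
    qed
  qed auto
  also have "\<dots> = finsum (R r) (term_at h f r) (pairs T S r)
      \<oplus>\<^bsub>R r\<^esub> finsum (R r) (term_at h g r) (pairs T S r)"
    by (rule finsum_addf) (use assms in \<open>auto simp: term_closed\<close>)
  also have "\<dots> = (h \<otimes>\<^bsub>P\<^esub> f \<oplus>\<^bsub>P\<^esub> h \<otimes>\<^bsub>P\<^esub> g) r"
    using r assms fin sub by (simp add: add_apply mult_apply[of _ _ _ T S])
  finally show "(h \<otimes>\<^bsub>P\<^esub> (f \<oplus>\<^bsub>P\<^esub> g)) r = (h \<otimes>\<^bsub>P\<^esub> f \<oplus>\<^bsub>P\<^esub> h \<otimes>\<^bsub>P\<^esub> g) r" .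
qed (auto simp: op_ext)

subsection \<open>Monomials\<close>

lemma monomial_ext: "monomial A G s a \<in> extensional (Mor G)"
  by (simp add: monomial_def)

lemma supp_monomial: "supp A G (monomial A G s a) \<subseteq> {s}"
  by (auto simp: supp_def monomial_def)

lemma monomial_closed:
  assumes "s \<in> Mor G" "a \<in> carrier (R s)"
  shows "monomial A G s a \<in> carrier P"
proof (rule carrierI[OF _ monomial_ext supp_monomial])
  fix r assume r: "r \<in> Mor G"
  interpret ring "R r" using r by (rule ring_R)
  show "monomial A G s a r \<in> carrier (R r)" using r assms by (simp add: monomial_def)
qed simp

lemma monomial_mult:
  assumes "s \<in> Mor G" "t \<in> Mor G" "a \<in> carrier (R s)" "b \<in> carrier (R t)"
  shows "monomial A G s a \<otimes>\<^bsub>P\<^esub> monomial A G t b =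
    (if composable G s t
     then monomial A G (s \<star>\<^bsub>G\<^esub> t) (a \<otimes>\<^bsub>R s\<^esub> \<sigma> s b \<otimes>\<^bsub>R s\<^esub> \<alpha> s t)
     else \<zero>\<^bsub>P\<^esub>)" (is "?l = ?r")
proof (rule ext_eqI)
  fix r assume r: "r \<in> Mor G"
  interpret ring "R r" using r by (rule ring_R)
  note cl = monomial_closed[OF assms(1,3)] monomial_closed[OF assms(2,4)]
  have eq: "?l r = finsum (R r) (term_at (monomial A G s a) (monomial A G t b) r) (pairs {s} {t} r)"
    by (rule mult_apply) (use cl r supp_monomial in auto)
  show "?l r = ?r r"
  proof (cases "composable G s t \<and> s \<star>\<^bsub>G\<^esub> t = r")
    case True
    then have "pairs {s} {t} r = {(s, t)}" by auto
    moreover have "a \<otimes>\<^bsub>R r\<^esub> \<sigma> s b \<otimes>\<^bsub>R r\<^esub> \<alpha> s t \<in> carrier (R r)"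
    proof -
      have "R r = R s" using True composableD(5) by auto
      then show ?thesis using True assms \<alpha>_closed[of s t] \<sigma>_closed[of s t b] by (metis m_closed)
    qed
    ultimately show ?thesis
      using True r assms unfolding eq by (auto simp: monomial_def composableD(5))
  next
    case False
    then have "pairs {s} {t} r = {}" by auto
    then have "?l r = \<zero>\<^bsub>R r\<^esub>" unfolding eq by (simp only: finsum_empty)
    then show ?thesis using False r by (auto simp: monomial_def zero_apply)
  qed
qed (auto simp: op_ext monomial_ext)

lemma carrier_induct [consumes 1, case_names zero monomial add]:
  assumes "f \<in> carrier P" and z: "Q \<zero>\<^bsub>P\<^esub>"
    and m: "\<And>s a. s \<in> Mor G \<Longrightarrow> a \<in> carrier (R s) \<Longrightarrow> Q (monomial A G s a)"
    and ad: "\<And>f g. f \<in> carrier P \<Longrightarrow> g \<in> carrier P \<Longrightarrow> Q f \<Longrightarrow> Q g \<Longrightarrow> Q (f \<oplus>\<^bsub>P\<^esub> g)"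
  shows "Q f"
proof -
  have "f \<in> carrier P \<Longrightarrow> supp A G f \<subseteq> S \<Longrightarrow> Q f" if "finite S" for S f
    using that
  proof (induction S arbitrary: f rule: finite_induct)
    case empty
    then have "f = \<zero>\<^bsub>P\<^esub>"
      by (intro ext_eqI) (auto simp: op_ext carrier_ext supp_def zero_apply)
    then show ?case using z by simp
  next
    case (insert s S)
    show ?case
    proof (cases "s \<in> Mor G")
      case False
      then show ?thesis using insert by (auto simp: supp_def intro!: insert.IH)
    next
      case s: True
      define g where "g = (\<lambda>r\<in>Mor G. if r = s then \<zero>\<^bsub>R r\<^esub> else f r)"
      have fs: "f s \<in> carrier (R s)" using insert.prems s by (simp add: carrier_memD)
      have supp_g: "supp A G g \<subseteq> S"
        using insert.prems by (auto simp: supp_def g_def)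
      have g: "g \<in> carrier P"
      proof (rule carrierI[OF _ _ supp_g insert.hyps(1)])
        fix r assume r: "r \<in> Mor G"
        interpret ring "R r" using r by (rule ring_R)
        show "g r \<in> carrier (R r)"
          by (simp only: g_def restrict_apply' r)
            (simp only: carrier_memD[OF insert.prems(1) r] zero_closed split: if_split, simp)
      qed (simp add: g_def)
      have "f = monomial A G s (f s) \<oplus>\<^bsub>P\<^esub> g"
      proof (rule ext_eqI)
        fix r assume r: "r \<in> Mor G"
        interpret ring "R r" using r by (rule ring_R)
        interpret Rs: ring "R s" using s by (rule ring_R)
        have "f r \<in> carrier (R r)" using r insert.prems by (simp add: carrier_memD)
        then show "f r = (monomial A G s (f s) \<oplus>\<^bsub>P\<^esub> g) r"
          using r by (cases "r = s") (auto simp: add_apply g_def monomial_def Rs.r_zero)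
      qed (use insert.prems in \<open>auto simp: op_ext carrier_ext\<close>)
      then show ?thesis
        using ad[OF monomial_closed[OF s fs] g m[OF s fs] insert.IH[OF g supp_g]] by simp
    qed
  qed
  then show ?thesis using assms(1) carrier_finite by blast
qed

lemma l_null_P: "f \<in> carrier P \<Longrightarrow> \<zero>\<^bsub>P\<^esub> \<otimes>\<^bsub>P\<^esub> f = \<zero>\<^bsub>P\<^esub>"
proof -
  assume f: "f \<in> carrier P"
  interpret P: abelian_group P by (rule abelian_group_P)
  have "\<zero>\<^bsub>P\<^esub> \<otimes>\<^bsub>P\<^esub> f \<oplus>\<^bsub>P\<^esub> \<zero>\<^bsub>P\<^esub> \<otimes>\<^bsub>P\<^esub> f = \<zero>\<^bsub>P\<^esub> \<otimes>\<^bsub>P\<^esub> f"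
    using l_distr_P[of "\<zero>\<^bsub>P\<^esub>" "\<zero>\<^bsub>P\<^esub>" f] f by simp
  then show ?thesis
    using P.add.l_cancel_one[of "\<zero>\<^bsub>P\<^esub> \<otimes>\<^bsub>P\<^esub> f" "\<zero>\<^bsub>P\<^esub> \<otimes>\<^bsub>P\<^esub> f"] mult_closed_P zero_closed_P f by simp
qed

lemma r_null_P: "f \<in> carrier P \<Longrightarrow> f \<otimes>\<^bsub>P\<^esub> \<zero>\<^bsub>P\<^esub> = \<zero>\<^bsub>P\<^esub>"
proof -
  assume f: "f \<in> carrier P"
  interpret P: abelian_group P by (rule abelian_group_P)
  have "f \<otimes>\<^bsub>P\<^esub> \<zero>\<^bsub>P\<^esub> \<oplus>\<^bsub>P\<^esub> f \<otimes>\<^bsub>P\<^esub> \<zero>\<^bsub>P\<^esub> = f \<otimes>\<^bsub>P\<^esub> \<zero>\<^bsub>P\<^esub>"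
    using r_distr_P[of "\<zero>\<^bsub>P\<^esub>" "\<zero>\<^bsub>P\<^esub>" f] f by simp
  then show ?thesis
    using P.add.l_cancel_one[of "f \<otimes>\<^bsub>P\<^esub> \<zero>\<^bsub>P\<^esub>" "f \<otimes>\<^bsub>P\<^esub> \<zero>\<^bsub>P\<^esub>"] mult_closed_P zero_closed_P f by simp
qed

lemma monomial_assoc:
  assumes "s \<in> Mor G" "t \<in> Mor G" "r \<in> Mor G"
    "a \<in> carrier (R s)" "b \<in> carrier (R t)" "x \<in> carrier (R r)"
  shows "monomial A G s a \<otimes>\<^bsub>P\<^esub> monomial A G t b \<otimes>\<^bsub>P\<^esub> monomial A G r x =
    monomial A G s a \<otimes>\<^bsub>P\<^esub> (monomial A G t b \<otimes>\<^bsub>P\<^esub> monomial A G r x)"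
proof -
  interpret ring "R s" using assms(1) by (rule ring_R)
  interpret Rt: ring "R t" using assms(2) by (rule ring_R)
  have ab: "composable G s t \<Longrightarrow> a \<otimes>\<^bsub>R s\<^esub> \<sigma> s b \<otimes>\<^bsub>R s\<^esub> \<alpha> s t \<in> carrier (R s)"
    using assms \<alpha>_closed \<sigma>_closed by auto
  have bx: "composable G t r \<Longrightarrow> b \<otimes>\<^bsub>R t\<^esub> \<sigma> t x \<otimes>\<^bsub>R t\<^esub> \<alpha> t r \<in> carrier (R t)"
    using assms \<alpha>_closed \<sigma>_closed by auto
  note cl = monomial_closed[OF assms(1,4)] monomial_closed[OF assms(2,5)] monomial_closed[OF assms(3,6)]
  have 1: "composable G s t \<Longrightarrow> composable G (s \<star>\<^bsub>G\<^esub> t) r \<longleftrightarrow> composable G t r"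
    by (auto simp: composable_def Dom_Comp Comp_Mor)
  have 2: "composable G t r \<Longrightarrow> composable G s (t \<star>\<^bsub>G\<^esub> r) \<longleftrightarrow> composable G s t"
    by (auto simp: composable_def Cod_Comp Comp_Mor)
  show ?thesis
  proof (cases "composable G s t"; cases "composable G t r")
    assume st: "composable G s t" and tr: "composable G t r"
    have M: "s \<star>\<^bsub>G\<^esub> t \<in> Mor G" "t \<star>\<^bsub>G\<^esub> r \<in> Mor G"
      "Cod G (s \<star>\<^bsub>G\<^esub> t) = Cod G s" "Cod G (t \<star>\<^bsub>G\<^esub> r) = Cod G t" "Dom G s = Cod G t" "Dom G t = Cod G r"
      using composableD[OF st] composableD[OF tr] by auto
    have c: "composable G (s \<star>\<^bsub>G\<^esub> t) r" "composable G s (t \<star>\<^bsub>G\<^esub> r)" using 1 2 st tr by auto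
    have cl': "\<sigma> s b \<in> carrier (R s)" "\<alpha> s t \<in> carrier (R s)" "\<sigma> (s \<star>\<^bsub>G\<^esub> t) x \<in> carrier (R s)"
      "\<alpha> (s \<star>\<^bsub>G\<^esub> t) r \<in> carrier (R s)" "\<sigma> t x \<in> carrier (R t)" "\<alpha> t r \<in> carrier (R t)"
      "\<alpha> s (t \<star>\<^bsub>G\<^esub> r) \<in> carrier (R s)" "\<sigma> s (\<sigma> t x) \<in> carrier (R s)" "\<sigma> s (\<alpha> t r) \<in> carrier (R s)"
      using \<alpha>_closed[OF st] \<alpha>_closed[OF tr] \<alpha>_closed[OF c(1)] \<alpha>_closed[OF c(2)]
        \<sigma>_closed[OF st assms(5)] \<sigma>_closed[OF tr assms(6)] \<sigma>_closed[OF c(1) assms(6)]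
        \<sigma>_closed[OF st \<sigma>_closed[OF tr assms(6)]] \<sigma>_closed[OF st \<alpha>_closed[OF tr]] M by auto
    have hom: "\<sigma> s (b \<otimes>\<^bsub>R t\<^esub> \<sigma> t x \<otimes>\<^bsub>R t\<^esub> \<alpha> t r) = \<sigma> s b \<otimes>\<^bsub>R s\<^esub> \<sigma> s (\<sigma> t x) \<otimes>\<^bsub>R s\<^esub> \<sigma> s (\<alpha> t r)"
      using ring_hom_mult[OF \<sigma>_hom[OF assms(1)]] M assms cl' by simp
    have tw: "\<sigma> s (\<sigma> t x) \<otimes>\<^bsub>R s\<^esub> \<alpha> s t = \<alpha> s t \<otimes>\<^bsub>R s\<^esub> \<sigma> (s \<star>\<^bsub>G\<^esub> t) x"
      using \<sigma>_twist[OF st, of x] M assms by simp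
    have "a \<otimes>\<^bsub>R s\<^esub> \<sigma> s b \<otimes>\<^bsub>R s\<^esub> \<alpha> s t \<otimes>\<^bsub>R s\<^esub> \<sigma> (s \<star>\<^bsub>G\<^esub> t) x \<otimes>\<^bsub>R s\<^esub> \<alpha> (s \<star>\<^bsub>G\<^esub> t) r
      = a \<otimes>\<^bsub>R s\<^esub> (\<sigma> s b \<otimes>\<^bsub>R s\<^esub> ((\<alpha> s t \<otimes>\<^bsub>R s\<^esub> \<sigma> (s \<star>\<^bsub>G\<^esub> t) x) \<otimes>\<^bsub>R s\<^esub> \<alpha> (s \<star>\<^bsub>G\<^esub> t) r))"
      using assms cl' by (simp add: m_assoc)
    also have "\<dots> = a \<otimes>\<^bsub>R s\<^esub> (\<sigma> s b \<otimes>\<^bsub>R s\<^esub> (\<sigma> s (\<sigma> t x) \<otimes>\<^bsub>R s\<^esub> (\<alpha> s t \<otimes>\<^bsub>R s\<^esub> \<alpha> (s \<star>\<^bsub>G\<^esub> t) r)))"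
      unfolding tw[symmetric] using assms cl' by (simp add: m_assoc)
    also have "\<dots> = a \<otimes>\<^bsub>R s\<^esub> \<sigma> s (b \<otimes>\<^bsub>R t\<^esub> \<sigma> t x \<otimes>\<^bsub>R t\<^esub> \<alpha> t r) \<otimes>\<^bsub>R s\<^esub> \<alpha> s (t \<star>\<^bsub>G\<^esub> r)"
      unfolding \<alpha>_cocycle[OF st tr] hom using assms cl' by (simp add: m_assoc)
    finally show ?thesis
      using st tr c M assms ab bx by (simp add: monomial_mult Comp_assoc)
  next
    assume st: "composable G s t" and tr: "\<not> composable G t r"
    then show ?thesis
      using 1 composableD[OF st] assms ab cl by (simp add: monomial_mult r_null_P)
  next
    assume st: "\<not> composable G s t" and tr: "composable G t r"
    then show ?thesis
      using 2 composableD[OF tr] assms bx cl by (simp add: monomial_mult l_null_P)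
  next
    assume st: "\<not> composable G s t" and tr: "\<not> composable G t r"
    then show ?thesis
      using assms cl by (simp add: monomial_mult l_null_P r_null_P)
  qed
qed

lemma m_assoc_P:
  assumes "f \<in> carrier P" "g \<in> carrier P" "h \<in> carrier P"
  shows "f \<otimes>\<^bsub>P\<^esub> g \<otimes>\<^bsub>P\<^esub> h = f \<otimes>\<^bsub>P\<^esub> (g \<otimes>\<^bsub>P\<^esub> h)"
  using assms
proof (induction f arbitrary: g h rule: carrier_induct)
  case zero
  then show ?case by (simp add: l_null_P mult_closed_P)
next
  case (add f f')
  then show ?case by (simp add: l_distr_P mult_closed_P)
next
  case (monomial s a)
  note sa = monomial_closed[OF monomial(1,2)]
  show ?case using monomial(3,4)
  proof (induction g arbitrary: h rule: carrier_induct)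
    case zero
    then show ?case using sa by (simp add: l_null_P r_null_P mult_closed_P)
  next
    case (add g g')
    then show ?case using sa by (simp add: l_distr_P r_distr_P mult_closed_P)
  next
    case (monomial t b)
    note tb = monomial_closed[OF monomial(1,2)]
    show ?case using monomial(3)
    proof (induction h rule: carrier_induct)
      case zero
      then show ?case using sa tb by (simp add: r_null_P mult_closed_P)
    next
      case (add h h')
      then show ?case using sa tb by (simp add: r_distr_P mult_closed_P)
    next
      case (monomial r x)
      then show ?case using monomial_assoc \<open>s \<in> Mor G\<close> \<open>a \<in> carrier (R s)\<close>
          \<open>t \<in> Mor G\<close> \<open>b \<in> carrier (R t)\<close> by blast
    qed
  qed
qed

subsection \<open>The identity\<close>

lemma Ob_Mor: "e \<in> Ob G \<Longrightarrow> e \<in> Mor G"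
  by (simp add: Ob_def)

lemma one_apply: "s \<in> Mor G \<Longrightarrow> \<one>\<^bsub>P\<^esub> s = (if s \<in> Ob G then \<one>\<^bsub>R s\<^esub> else \<zero>\<^bsub>R s\<^esub>)"
  by (simp add: crossed_product_def Cod_id)

lemma supp_one: "supp A G \<one>\<^bsub>P\<^esub> \<subseteq> Ob G"
  by (auto simp: supp_def one_apply split: if_splits)

lemma one_closed_P:
  assumes "finite (Ob G)"
  shows "\<one>\<^bsub>P\<^esub> \<in> carrier P"
proof (rule carrierI[OF _ op_ext(4) supp_one assms])
  fix s assume s: "s \<in> Mor G"
  interpret ring "R s" using s by (rule ring_R)
  show "\<one>\<^bsub>P\<^esub> s \<in> carrier (R s)" using s by (simp add: one_apply)
qed

lemma Ob_Comp: "composable G e t \<Longrightarrow> e \<in> Ob G \<Longrightarrow> e = Cod G t \<and> e \<star>\<^bsub>G\<^esub> t = t"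
  using Cod_Comp_id by (auto simp: composable_def Ob_def)

lemma Comp_Ob: "composable G s e \<Longrightarrow> e \<in> Ob G \<Longrightarrow> e = Dom G s \<and> s \<star>\<^bsub>G\<^esub> e = s"
  using Comp_Dom Cod_id by (auto simp: composable_def)

lemma l_one_P:
  assumes fin: "finite (Ob G)" and f: "f \<in> carrier P"
  shows "\<one>\<^bsub>P\<^esub> \<otimes>\<^bsub>P\<^esub> f = f"
proof (rule ext_eqI)
  fix r assume r: "r \<in> Mor G"
  interpret ring "R r" using r by (rule ring_R)
  have e: "Cod G r \<in> Ob G" "Cod G r \<in> Mor G" "Cod G (Cod G r) = Cod G r" "Dom G (Cod G r) = Cod G r"
    using r Cod_Ob[OF r] Cod_id by (auto simp: Ob_def)
  have fr: "f r \<in> carrier (R r)" using f r by (rule carrier_memD)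
  have eq: "pairs (Ob G) (insert r (supp A G f)) r = {(Cod G r, r)}"
  proof -
    have *: "(s, t) \<in> pairs (Ob G) (insert r (supp A G f)) r \<longleftrightarrow> (s, t) = (Cod G r, r)" for s t
      using r e Ob_Comp[of s t] Cod_Comp_id[OF r] by (auto simp: composable_def)
    show ?thesis
    proof (rule Set.set_eqI)
      fix p
      show "p \<in> pairs (Ob G) (insert r (supp A G f)) r \<longleftrightarrow> p \<in> {(Cod G r, r)}"
        using * by (cases p) simp
    qed
  qed
  have "(\<one>\<^bsub>P\<^esub> \<otimes>\<^bsub>P\<^esub> f) r = finsum (R r) (term_at \<one>\<^bsub>P\<^esub> f r) (pairs (Ob G) (insert r (supp A G f)) r)"
    by (rule mult_apply) (use fin f r one_closed_P supp_one carrier_finite in auto)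
  also have "\<dots> = f r"
    unfolding eq using e r fr \<sigma>_id[OF e(1) fr] \<alpha>_Cod[OF r] by (simp add: one_apply)
  finally show "(\<one>\<^bsub>P\<^esub> \<otimes>\<^bsub>P\<^esub> f) r = f r" .
qed (use f in \<open>auto simp: op_ext carrier_ext\<close>)

lemma r_one_P:
  assumes fin: "finite (Ob G)" and f: "f \<in> carrier P"
  shows "f \<otimes>\<^bsub>P\<^esub> \<one>\<^bsub>P\<^esub> = f"
proof (rule ext_eqI)
  fix r assume r: "r \<in> Mor G"
  interpret ring "R r" using r by (rule ring_R)
  have e: "Dom G r \<in> Ob G" "Dom G r \<in> Mor G" "Cod G (Dom G r) = Dom G r" "Dom G (Dom G r) = Dom G r"
    using r Dom_Ob[OF r] Cod_id by (auto simp: Ob_def)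
  have fr: "f r \<in> carrier (R r)" using f r by (rule carrier_memD)
  have eq: "pairs (insert r (supp A G f)) (Ob G) r = {(r, Dom G r)}"
    using r e Comp_Ob Comp_Dom by (auto simp: composable_def dest: Ob_Mor)
  have "(f \<otimes>\<^bsub>P\<^esub> \<one>\<^bsub>P\<^esub>) r = finsum (R r) (term_at f \<one>\<^bsub>P\<^esub> r) (pairs (insert r (supp A G f)) (Ob G) r)"
    by (rule mult_apply) (use fin f r one_closed_P supp_one carrier_finite in auto)
  also have "\<dots> = f r"
    unfolding eq using e r fr ring_hom_one[OF \<sigma>_hom[OF r]] \<alpha>_Dom[OF r] by (simp add: one_apply)
  finally show "(f \<otimes>\<^bsub>P\<^esub> \<one>\<^bsub>P\<^esub>) r = f r" .
qed (use f in \<open>auto simp: op_ext carrier_ext\<close>)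

theorem ring_crossed_product:
  assumes "finite (Ob G)"
  shows "ring P"
proof (rule ringI[OF abelian_group_P])
  show "monoid P"
    by (rule monoidI)
      (use assms in \<open>auto simp: mult_closed_P one_closed_P m_assoc_P l_one_P r_one_P\<close>)
qed (auto simp: l_distr_P r_distr_P)

end

end

theory Submission
  imports Defs
begin

text \<open>
  The argument is one of minimal support.  Let \<open>f\<close> be a nonzero element of \<open>I\<close> whose support has
  the least possible size, and let \<open>s\<close> lie in that support.  Multiplying \<open>f\<close> on the right by
  \<open>u\<^bsub>s\<^sup>-\<^sup>1\<^esub>\<close> moves the coefficient at \<open>s\<close> to the object \<open>c(s)\<close>, up to the factor \<open>\<alpha>(s, s\<^sup>-\<^sup>1)\<close>;
  as this factor is not a zero divisor, the result \<open>g\<close> still has a nonzero coefficient at an object.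
  Right multiplication by a monomial cannot enlarge the support (\<open>card_supp_mult_monomial\<close>), so \<open>g\<close>
  is again of minimal support.

  For every \<open>a\<close> in \<open>A\<close> the commutator \<open>ag - ga\<close> lies in \<open>I\<close>.  Its support is contained in that of
  \<open>g\<close>, because multiplication by elements of \<open>A\<close> from either side acts coefficientwise
  (\<open>coeff_mult_apply\<close>, \<open>mult_coeff_apply\<close>), and it omits the object \<open>c(s)\<close>, because there the
  coefficient is a commutator in the commutative ring \<open>A\<^bsub>c(s)\<^esub>\<close>.  By minimality the commutator
  vanishes.  So \<open>g\<close> lies in the commutant of \<open>A\<close>, which is \<open>A\<close> itself.
\<close>

section \<open>Commutation with the coefficient ring\<close>

context crossed_system
begin

lemma eq_zero_iff_supp_empty:
  assumes "f \<in> carrier P"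
  shows "f = \<zero>\<^bsub>P\<^esub> \<longleftrightarrow> supp A G f = {}"
proof
  assume "supp A G f = {}"
  then show "f = \<zero>\<^bsub>P\<^esub>"
    using assms by (intro ext_eqI) (auto simp: op_ext carrier_ext supp_def zero_apply)
qed (auto simp: supp_def zero_apply)

text \<open>
  The only factorisations of \<open>r\<close> that have an object on the left (on the right) are
  \<open>c(r) \<star> r\<close> (respectively \<open>r \<star> d(r)\<close>), and the twist \<open>\<alpha>\<close> is trivial on them.
\<close>

lemma coeff_mult_apply:
  assumes a: "a \<in> coeff_ring A G \<sigma> \<alpha>" and f: "f \<in> carrier P" and r: "r \<in> Mor G"
  shows "(a \<otimes>\<^bsub>P\<^esub> f) r = a (Cod G r) \<otimes>\<^bsub>R r\<^esub> f r"
proof -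
  interpret ring "R r" using r by (rule ring_R)
  have e: "Cod G r \<in> Ob G" "Cod G r \<in> Mor G" "Cod G (Cod G r) = Cod G r" "Dom G (Cod G r) = Cod G r"
    using r Cod_Ob[OF r] Cod_id by (auto simp: Ob_def)
  have aP: "a \<in> carrier P" and supp_a: "supp A G a \<subseteq> Ob G"
    using a by (auto simp: coeff_ring_def)
  have fr: "f r \<in> carrier (R r)" using f r by (rule carrier_memD)
  have ar: "a (Cod G r) \<in> carrier (R r)" using carrier_memD[OF aP e(2)] e by simp
  \<comment> \<open>Enlarging the supports makes the index set a singleton even if the coefficients vanish.\<close>
  let ?S = "insert (Cod G r) (supp A G a)" and ?T = "insert r (supp A G f)"
  have c: "composable G (Cod G r) r" using r e by (simp add: composable_def)
  have uniq: "s = Cod G r \<and> t = r"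
    if "s \<in> ?S" "composable G s t" "s \<star>\<^bsub>G\<^esub> t = r" for s t
  proof -
    have "s \<in> Ob G" using that(1) supp_a e by blast
    then show ?thesis using Ob_Comp[OF that(2)] that(3) by metis
  qed
  have eq: "pairs ?S ?T r = {(Cod G r, r)}"
    using uniq c Cod_Comp_id[OF r] by fast
  have "(a \<otimes>\<^bsub>P\<^esub> f) r = finsum (R r) (term_at a f r) (pairs ?S ?T r)"
    by (rule mult_apply) (use aP f r carrier_finite in auto)
  also have "\<dots> = a (Cod G r) \<otimes>\<^bsub>R r\<^esub> f r"
    unfolding eq using e r fr ar \<sigma>_id[OF e(1) fr] \<alpha>_Cod[OF r] by simp
  finally show ?thesis .
qed

lemma mult_coeff_apply:
  assumes a: "a \<in> coeff_ring A G \<sigma> \<alpha>" and f: "f \<in> carrier P" and r: "r \<in> Mor G"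
  shows "(f \<otimes>\<^bsub>P\<^esub> a) r = f r \<otimes>\<^bsub>R r\<^esub> \<sigma> r (a (Dom G r))"
proof -
  interpret ring "R r" using r by (rule ring_R)
  have e: "Dom G r \<in> Ob G" "Dom G r \<in> Mor G" "Cod G (Dom G r) = Dom G r" "Dom G (Dom G r) = Dom G r"
    using r Dom_Ob[OF r] Cod_id by (auto simp: Ob_def)
  have aP: "a \<in> carrier P" and supp_a: "supp A G a \<subseteq> Ob G"
    using a by (auto simp: coeff_ring_def)
  have fr: "f r \<in> carrier (R r)" using f r by (rule carrier_memD)
  have c: "composable G r (Dom G r)" using r e by (simp add: composable_def)
  have ar: "\<sigma> r (a (Dom G r)) \<in> carrier (R r)"
    using \<sigma>_closed[OF c carrier_memD[OF aP e(2)]] .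
  let ?S = "insert r (supp A G f)" and ?T = "insert (Dom G r) (supp A G a)"
  have uniq: "s = r \<and> t = Dom G r"
    if "t \<in> ?T" "composable G s t" "s \<star>\<^bsub>G\<^esub> t = r" for s t
  proof -
    have "t \<in> Ob G" using that(1) supp_a e by blast
    then show ?thesis using Comp_Ob[OF that(2)] that(3) by metis
  qed
  have eq: "pairs ?S ?T r = {(r, Dom G r)}"
    using uniq c Comp_Dom[OF r] by fast
  have "(f \<otimes>\<^bsub>P\<^esub> a) r = finsum (R r) (term_at f a r) (pairs ?S ?T r)"
    by (rule mult_apply) (use aP f r carrier_finite in auto)
  also have "\<dots> = f r \<otimes>\<^bsub>R r\<^esub> \<sigma> r (a (Dom G r))"
    unfolding eq using e r fr ar \<alpha>_Dom[OF r] by simp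
  finally show ?thesis .
qed

lemma coeff_ring_fibre_comm:
  assumes comm: "\<And>x y. x \<in> coeff_ring A G \<sigma> \<alpha> \<Longrightarrow> y \<in> coeff_ring A G \<sigma> \<alpha> \<Longrightarrow>
      x \<otimes>\<^bsub>P\<^esub> y = y \<otimes>\<^bsub>P\<^esub> x"
    and e: "e \<in> Ob G" and ab: "a \<in> carrier (A e)" "b \<in> carrier (A e)"
  shows "a \<otimes>\<^bsub>A e\<^esub> b = b \<otimes>\<^bsub>A e\<^esub> a"
proof -
  have eM: "e \<in> Mor G" and ce: "Cod G e = e" using e Ob_Mor Cod_id by auto
  have mono: "monomial A G e x \<in> coeff_ring A G \<sigma> \<alpha>" if "x \<in> carrier (A e)" for x
    using monomial_closed[of e x] supp_monomial[of e x] that eM ce e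
    by (auto simp: coeff_ring_def)
  have "(monomial A G e x \<otimes>\<^bsub>P\<^esub> monomial A G e y) e = x \<otimes>\<^bsub>A e\<^esub> y"
    if "x \<in> carrier (A e)" "y \<in> carrier (A e)" for x y
    using coeff_mult_apply[OF mono[OF that(1)] monomial_closed[of e y] eM] that eM ce
    by (simp add: monomial_def)
  then show ?thesis using comm[OF mono mono] ab by metis
qed

lemma supp_mult_monomial:
  assumes "f \<in> carrier P" "t \<in> Mor G" "b \<in> carrier (R t)"
  shows "supp A G (f \<otimes>\<^bsub>P\<^esub> monomial A G t b) \<subseteq> (\<lambda>s. s \<star>\<^bsub>G\<^esub> t) ` supp A G f"
proof (rule subsetI, rule ccontr)
  fix r assume r: "r \<in> supp A G (f \<otimes>\<^bsub>P\<^esub> monomial A G t b)"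
    and n: "r \<notin> (\<lambda>s. s \<star>\<^bsub>G\<^esub> t) ` supp A G f"
  have rM: "r \<in> Mor G" using r by (simp add: supp_def)
  interpret ring "R r" using rM by (rule ring_R)
  have "pairs (supp A G f) {t} r = {}" using n by auto
  moreover have "(f \<otimes>\<^bsub>P\<^esub> monomial A G t b) r =
      finsum (R r) (term_at f (monomial A G t b) r) (pairs (supp A G f) {t} r)"
    by (rule mult_apply) (use assms rM monomial_closed supp_monomial carrier_finite in auto)
  ultimately have "(f \<otimes>\<^bsub>P\<^esub> monomial A G t b) r = \<zero>\<^bsub>R r\<^esub>" by (simp only: finsum_empty)
  then show False using r by (simp add: supp_def)
qed

lemma card_supp_mult_monomial:
  assumes "f \<in> carrier P" "t \<in> Mor G" "b \<in> carrier (R t)"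
  shows "card (supp A G (f \<otimes>\<^bsub>P\<^esub> monomial A G t b)) \<le> card (supp A G f)"
  by (rule surj_card_le[OF carrier_finite[OF assms(1)] supp_mult_monomial[OF assms]])

text \<open>
  At \<open>r\<close> the two products are \<open>a\<^bsub>c(r)\<^esub> f\<^sub>r\<close> and \<open>f\<^sub>r \<sigma>\<^sub>r(a\<^bsub>d(r)\<^esub>)\<close>.  Both vanish with \<open>f\<^sub>r\<close>, and if \<open>r\<close> is an
  object they are the two products of \<open>a\<^sub>r\<close> and \<open>f\<^sub>r\<close> in the commutative ring \<open>A\<^sub>r\<close>.
\<close>

lemma commutator_supp:
  assumes fin: "finite (Ob G)"
    and comm: "\<And>x y. x \<in> coeff_ring A G \<sigma> \<alpha> \<Longrightarrow> y \<in> coeff_ring A G \<sigma> \<alpha> \<Longrightarrow>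
      x \<otimes>\<^bsub>P\<^esub> y = y \<otimes>\<^bsub>P\<^esub> x"
    and a: "a \<in> coeff_ring A G \<sigma> \<alpha>" and f: "f \<in> carrier P"
  shows "supp A G (a \<otimes>\<^bsub>P\<^esub> f \<ominus>\<^bsub>P\<^esub> f \<otimes>\<^bsub>P\<^esub> a) \<subseteq> supp A G f - Ob G"
proof
  fix r assume r: "r \<in> supp A G (a \<otimes>\<^bsub>P\<^esub> f \<ominus>\<^bsub>P\<^esub> f \<otimes>\<^bsub>P\<^esub> a)"
  then have rM: "r \<in> Mor G" by (simp add: supp_def)
  interpret Rr: ring "R r" using rM by (rule ring_R)
  interpret P: ring P using fin by (rule ring_crossed_product)
  define d where "d = a \<otimes>\<^bsub>P\<^esub> f \<ominus>\<^bsub>P\<^esub> f \<otimes>\<^bsub>P\<^esub> a"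
  have aP: "a \<in> carrier P" using a by (simp add: coeff_ring_def)
  have d: "d \<in> carrier P" using aP f by (simp add: d_def)
  have "d \<oplus>\<^bsub>P\<^esub> f \<otimes>\<^bsub>P\<^esub> a = a \<otimes>\<^bsub>P\<^esub> f"
    using aP f by (simp add: d_def a_minus_def P.a_assoc P.l_neg)
  then have sum: "d r \<oplus>\<^bsub>R r\<^esub> (f \<otimes>\<^bsub>P\<^esub> a) r = (a \<otimes>\<^bsub>P\<^esub> f) r"
    using add_apply[OF rM] by metis
  have cl: "d r \<in> carrier (R r)" "(f \<otimes>\<^bsub>P\<^esub> a) r \<in> carrier (R r)"
    using d f aP rM by (auto intro: carrier_memD)
  have ne: "(f \<otimes>\<^bsub>P\<^esub> a) r \<noteq> (a \<otimes>\<^bsub>P\<^esub> f) r"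
  proof
    assume "(f \<otimes>\<^bsub>P\<^esub> a) r = (a \<otimes>\<^bsub>P\<^esub> f) r"
    then have "d r = \<zero>\<^bsub>R r\<^esub>" using sum cl by simp
    then show False using r by (simp add: supp_def d_def)
  qed
  have e: "Cod G r \<in> Ob G" "Dom G r \<in> Ob G" using rM Cod_Ob Dom_Ob by auto
  have ac: "a (Cod G r) \<in> carrier (R r)"
    using carrier_memD[OF aP Ob_Mor[OF e(1)]] Cod_id[OF e(1)] by simp
  have c: "composable G r (Dom G r)" using rM e Ob_Mor Cod_id by (simp add: composable_def)
  have ad: "\<sigma> r (a (Dom G r)) \<in> carrier (R r)"
    using \<sigma>_closed[OF c carrier_memD[OF aP Ob_Mor[OF e(2)]]] .
  note app = coeff_mult_apply[OF a f rM] mult_coeff_apply[OF a f rM]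
  have "r \<in> supp A G f"
    using ne app ac ad rM by (auto simp: supp_def)
  moreover have "r \<notin> Ob G"
  proof
    assume o: "r \<in> Ob G"
    then have eq: "Cod G r = r" "Dom G r = r" using Cod_id by (auto simp: Ob_def)
    have "a r \<in> carrier (A r)" "f r \<in> carrier (A r)"
      using ac eq carrier_memD[OF f rM] by auto
    then have "(f \<otimes>\<^bsub>P\<^esub> a) r = (a \<otimes>\<^bsub>P\<^esub> f) r"
      using app eq \<sigma>_id[OF o] coeff_ring_fibre_comm[OF comm o] by simp
    then show False using ne by simp
  qed
  ultimately show "r \<in> supp A G f - Ob G" by simp
qed

text \<open>
  The commutator of \<open>f\<close> with an element of \<open>A\<close> lies in the ideal and is shorter than \<open>f\<close>, since it
  loses at least the object \<open>e\<close>; minimality therefore forces it to vanish.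
\<close>

lemma minimal_supp_in_commutant:
  assumes fin: "finite (Ob G)"
    and comm: "\<And>x y. x \<in> coeff_ring A G \<sigma> \<alpha> \<Longrightarrow> y \<in> coeff_ring A G \<sigma> \<alpha> \<Longrightarrow>
      x \<otimes>\<^bsub>P\<^esub> y = y \<otimes>\<^bsub>P\<^esub> x"
    and I: "ideal I P" and f: "f \<in> I"
    and e: "e \<in> supp A G f" "e \<in> Ob G"
    and min: "\<And>h. h \<in> I \<Longrightarrow> h \<noteq> \<zero>\<^bsub>P\<^esub> \<Longrightarrow> card (supp A G f) \<le> card (supp A G h)"
  shows "f \<in> commutant P (coeff_ring A G \<sigma> \<alpha>)"
proof -
  interpret I: ideal I P by (rule I)
  note sub = I.additive_subgroup_axioms
  have fP: "f \<in> carrier P" using f I.a_subset by auto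
  have "f \<otimes>\<^bsub>P\<^esub> a = a \<otimes>\<^bsub>P\<^esub> f" if a: "a \<in> coeff_ring A G \<sigma> \<alpha>" for a
  proof -
    have aP: "a \<in> carrier P" using a by (simp add: coeff_ring_def)
    let ?d = "a \<otimes>\<^bsub>P\<^esub> f \<ominus>\<^bsub>P\<^esub> f \<otimes>\<^bsub>P\<^esub> a"
    have "?d \<in> I"
      using f aP unfolding a_minus_def
      by (intro additive_subgroup.a_closed[OF sub] additive_subgroup.a_inv_closed[OF sub]
          I.I_l_closed I.I_r_closed)
    moreover have "card (supp A G ?d) < card (supp A G f)"
      using commutator_supp[OF fin comm a fP] e
      by (intro psubset_card_mono carrier_finite fP) blast
    ultimately have "?d = \<zero>\<^bsub>P\<^esub>" using min[of ?d] by fastforce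
    then show ?thesis
      using I.minus_equality[of "a \<otimes>\<^bsub>P\<^esub> f" "\<ominus>\<^bsub>P\<^esub> (f \<otimes>\<^bsub>P\<^esub> a)"] aP fP
      by (simp add: a_minus_def)
  qed
  then show ?thesis using fP by (simp add: commutant_def)
qed

end

section \<open>Shifting a coefficient to an object\<close>

locale groupoid_crossed_system = crossed_system A G \<sigma> \<alpha> + groupoid G
  for A :: "'g \<Rightarrow> ('a, 'm) ring_scheme"
    and G :: "('g, 'n) category_data_scheme"
    and \<sigma> :: "'g \<Rightarrow> 'a \<Rightarrow> 'a"
    and \<alpha> :: "'g \<Rightarrow> 'g \<Rightarrow> 'a"
begin

text \<open>
  The coefficient of \<open>f u\<^sub>t\<close> at \<open>s \<star> t\<close> comes from \<open>s\<close> alone because \<open>t\<close> can be cancelled on the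
  right in a groupoid; for \<open>t = s\<^sup>-\<^sup>1\<close> this gives the following.
\<close>

lemma mult_u_inv_apply_Cod:
  assumes f: "f \<in> carrier P" and s: "s \<in> Mor G"
  defines "t \<equiv> mor_inv G s"
  shows "(f \<otimes>\<^bsub>P\<^esub> monomial A G t \<one>\<^bsub>R t\<^esub>) (Cod G s) = f s \<otimes>\<^bsub>R s\<^esub> \<alpha> s t"
proof -
  have inv: "composable G s t" "composable G t s" "s \<star>\<^bsub>G\<^esub> t = Cod G s" "t \<star>\<^bsub>G\<^esub> s = Dom G s"
    using mor_inv_is_inverse[OF s] by (auto simp: is_inverse_def t_def)
  have t: "t \<in> Mor G" using inv composableD by blast
  let ?e = "Cod G s" and ?u = "monomial A G t \<one>\<^bsub>R t\<^esub>"
  have e: "?e \<in> Mor G" "Cod G ?e = ?e" using Cod_Ob[OF s] Ob_Mor Cod_id by auto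
  interpret ring "R s" using s by (rule ring_R)
  interpret Rt: ring "R t" using t by (rule ring_R)
  have u: "?u \<in> carrier P" using t by (simp add: monomial_closed)
  have cancel: "s' = s" if st: "composable G s' t" and eq: "s' \<star>\<^bsub>G\<^esub> t = ?e" for s'
  proof -
    have "s' = s' \<star>\<^bsub>G\<^esub> (t \<star>\<^bsub>G\<^esub> s)"
      using inv st composableD[OF st] composableD[OF inv(1)] composableD[OF inv(2)]
        Comp_Dom[of s'] by simp
    also have "\<dots> = ?e \<star>\<^bsub>G\<^esub> s" using Comp_assoc[OF st inv(2)] eq by simp
    also have "\<dots> = s" using s by (rule Cod_Comp_id)
    finally show ?thesis .
  qed
  have eq: "pairs (insert s (supp A G f)) {t} ?e = {(s, t)}"
    using cancel inv by fast
  have "(f \<otimes>\<^bsub>P\<^esub> ?u) ?e =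
      finsum (R ?e) (term_at f ?u ?e) (pairs (insert s (supp A G f)) {t} ?e)"
    by (rule mult_apply) (use f u e supp_monomial carrier_finite in auto)
  also have "\<dots> = f s \<otimes>\<^bsub>R s\<^esub> \<sigma> s \<one>\<^bsub>R t\<^esub> \<otimes>\<^bsub>R s\<^esub> \<alpha> s t"
    unfolding eq using e t term_closed[OF f u inv(1) inv(3)] by (simp add: monomial_def)
  also have "\<sigma> s \<one>\<^bsub>R t\<^esub> = \<one>\<^bsub>R s\<^esub>"
    using ring_hom_one[OF \<sigma>_hom[OF s]] composableD(3)[OF inv(1)] by simp
  finally show ?thesis using carrier_memD[OF f s] by simp
qed

end

section \<open>Ideals meet the coefficient ring\<close>

theorem corollary5:
  fixes A :: "'g \<Rightarrow> ('a, 'm) ring_scheme"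
    and G :: "('g, 'n) category_data_scheme"
    and \<sigma> :: "'g \<Rightarrow> 'a \<Rightarrow> 'a"
    and \<alpha> :: "'g \<Rightarrow> 'g \<Rightarrow> 'a"
    and I :: "('g \<Rightarrow> 'a) set"
  assumes "crossed_system A G \<sigma> \<alpha>"
    and "groupoid G"
    and "finite (Ob G)"
    and "maximal_commutative (crossed_product A G \<sigma> \<alpha>) (coeff_ring A G \<sigma> \<alpha>)"
    and "\<And>s. s \<in> Mor G \<Longrightarrow> \<not> zero_divisor (A (Cod G s)) (\<alpha> s (mor_inv G s))"
    and "ideal I (crossed_product A G \<sigma> \<alpha>)"
    and "I \<noteq> {\<zero>\<^bsub>crossed_product A G \<sigma> \<alpha>\<^esub>}"
  shows "I \<inter> coeff_ring A G \<sigma> \<alpha> \<noteq> {\<zero>\<^bsub>crossed_product A G \<sigma> \<alpha>\<^esub>}"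
proof -
  interpret groupoid_crossed_system A G \<sigma> \<alpha>
    using assms(1,2) by (rule groupoid_crossed_system.intro)
  interpret I: ideal I P by (rule assms(6))
  have comm: "x \<otimes>\<^bsub>P\<^esub> y = y \<otimes>\<^bsub>P\<^esub> x" if "x \<in> coeff_ring A G \<sigma> \<alpha>" "y \<in> coeff_ring A G \<sigma> \<alpha>" for x y
    using assms(4) that unfolding maximal_commutative_def by blast
  obtain f\<^sub>0 where "f\<^sub>0 \<in> I \<and> f\<^sub>0 \<noteq> \<zero>\<^bsub>P\<^esub>"
    using assms(7) additive_subgroup.zero_closed[OF I.additive_subgroup_axioms] by blast
  from ex_has_least_nat[where P = "\<lambda>f. f \<in> I \<and> f \<noteq> \<zero>\<^bsub>P\<^esub>", OF this, of "\<lambda>f. card (supp A G f)"]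
  obtain f where f: "f \<in> I" "f \<noteq> \<zero>\<^bsub>P\<^esub>"
    and min: "\<And>h. h \<in> I \<Longrightarrow> h \<noteq> \<zero>\<^bsub>P\<^esub> \<Longrightarrow> card (supp A G f) \<le> card (supp A G h)"
    by auto
  have fP: "f \<in> carrier P" using f I.a_subset by auto
  obtain s where "s \<in> supp A G f" using f fP eq_zero_iff_supp_empty by blast
  then have s: "s \<in> Mor G" and fs: "f s \<noteq> \<zero>\<^bsub>R s\<^esub>" by (auto simp: supp_def)

  define t where "t = mor_inv G s"
  have st: "composable G s t" using mor_inv_is_inverse[OF s] by (simp add: is_inverse_def t_def)
  have t: "t \<in> Mor G" using st composableD by blast
  interpret Rt: ring "R t" using t by (rule ring_R)
  define g where "g = f \<otimes>\<^bsub>P\<^esub> monomial A G t \<one>\<^bsub>R t\<^esub>"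
  have g: "g \<in> I" using f t by (simp add: g_def I.I_r_closed monomial_closed)
  have gP: "g \<in> carrier P" using g I.a_subset by auto
  have e: "Cod G s \<in> Ob G" using s by (rule Cod_Ob)
  have "g (Cod G s) = \<alpha> s t \<otimes>\<^bsub>R s\<^esub> f s"
    using mult_u_inv_apply_Cod[OF fP s]
      coeff_ring_fibre_comm[OF comm e carrier_memD[OF fP s] \<alpha>_closed[OF st]]
    by (simp add: g_def t_def)
  then have "g (Cod G s) \<noteq> \<zero>\<^bsub>R s\<^esub>"
    using assms(5)[OF s] fs carrier_memD[OF fP s] by (auto simp: zero_divisor_def t_def)
  then have eg: "Cod G s \<in> supp A G g" using e Ob_Mor Cod_id by (simp add: supp_def)
  have "card (supp A G g) \<le> card (supp A G f)"
    using card_supp_mult_monomial[OF fP t] by (simp add: g_def)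
  then have "g \<in> commutant P (coeff_ring A G \<sigma> \<alpha>)"
    using minimal_supp_in_commutant[OF assms(3) comm assms(6) g eg e] min by (meson order_trans)
  then have "g \<in> I \<inter> coeff_ring A G \<sigma> \<alpha>"
    using g assms(4) by (simp add: maximal_commutative_def)
  moreover have "g \<noteq> \<zero>\<^bsub>P\<^esub>" using eg eq_zero_iff_supp_empty[OF gP] by blast
  ultimately show ?thesis by blast
qed

end
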